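(* As $n\to\infty$, there are at least $2^{(\sqrt{2/\pi}-o(1))\,2^n/n^{3/2}}$ irreducible supermodular functions $f\colon 2^{[n]}\to\mathbb{R}$, up to equivalence.
   Context: A function $f\colon 2^{[n]}\to\mathbb{R}$ is supermodular if $f(I\cap J)+f(I\cup J)\ge f(I)+f(J)$ for all $I,J\subseteq[n]$, and modular if equality always holds. Two supermodular functions are equivalent if they differ by a modular function. A supermodular $f$ is irreducible if it is not modular and whenever $f=g_1+g_2$ with $g_1,g_2$ supermodular, each $g_i$ is equivalent to $c_if$ for some $c_i\ge0$. Irreducible functions are counted up to equivalence and positive scaling ($f$ and $g$ identified if $g-cf$ is modular for some $c>0$). *)

theory Defs
  imports Complex_Main "HOL-Library.Landau_Symbols"
begin

text \<open>
  A function \<open>2\<^sup>E \<rightarrow> \<real>\<close> is represented by a function on \<^typ>\<open>'a set\<close> of which only the values on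
  subsets of \<open>E\<close> matter: all notions below inspect these values only, and functions that agree
  on the subsets of \<open>E\<close> lie in the same class of \<open>ray_equiv E\<close>.
\<close>

definition supermodular_on :: "'a set \<Rightarrow> ('a set \<Rightarrow> real) \<Rightarrow> bool" where
  "supermodular_on E f \<longleftrightarrow> (\<forall>I\<subseteq>E. \<forall>J\<subseteq>E. f (I \<inter> J) + f (I \<union> J) \<ge> f I + f J)"

definition modular_on :: "'a set \<Rightarrow> ('a set \<Rightarrow> real) \<Rightarrow> bool" where
  "modular_on E f \<longleftrightarrow> (\<forall>I\<subseteq>E. \<forall>J\<subseteq>E. f (I \<inter> J) + f (I \<union> J) = f I + f J)"

definition equivalent_on :: "'a set \<Rightarrow> ('a set \<Rightarrow> real) \<Rightarrow> ('a set \<Rightarrow> real) \<Rightarrow> bool" where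
  "equivalent_on E f g \<longleftrightarrow> modular_on E (\<lambda>I. f I - g I)"

definition irreducible_on :: "'a set \<Rightarrow> ('a set \<Rightarrow> real) \<Rightarrow> bool" where
  "irreducible_on E f \<longleftrightarrow>
     supermodular_on E f \<and> \<not> modular_on E f \<and>
     (\<forall>g1 g2. supermodular_on E g1 \<longrightarrow> supermodular_on E g2 \<longrightarrow>
        (\<forall>I\<subseteq>E. f I = g1 I + g2 I) \<longrightarrow>
        (\<exists>c1\<ge>0. equivalent_on E g1 (\<lambda>I. c1 * f I)) \<and>
        (\<exists>c2\<ge>0. equivalent_on E g2 (\<lambda>I. c2 * f I)))"

definition ray_equiv :: "'a set \<Rightarrow> (('a set \<Rightarrow> real) \<times> ('a set \<Rightarrow> real)) set" where
  "ray_equiv E = {(f, g). irreducible_on E f \<and> irreducible_on E g \<and>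
                     (\<exists>c>0. modular_on E (\<lambda>I. g I - c * f I))}"

definition irreducible_classes :: "'a set \<Rightarrow> ('a set \<Rightarrow> real) set set" where
  "irreducible_classes E = {f. irreducible_on E f} // ray_equiv E"

lemma modular_on_lin:
  assumes "modular_on E f" "modular_on E g"
  shows "modular_on E (\<lambda>I. a * f I + b * g I)"
proof -
  have "a * f (I \<inter> J) + b * g (I \<inter> J) + (a * f (I \<union> J) + b * g (I \<union> J))
      = a * f I + b * g I + (a * f J + b * g J)" if "I \<subseteq> E" "J \<subseteq> E" for I J
  proof -
    have "f (I \<inter> J) = f I + f J - f (I \<union> J)" "g (I \<inter> J) = g I + g J - g (I \<union> J)"
      using assms that by (simp_all add: modular_on_def eq_diff_eq)
    then show ?thesis by (simp only:) (simp add: algebra_simps)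
  qed
  then show ?thesis by (simp add: modular_on_def)
qed

lemma equiv_ray_equiv: "equiv {f. irreducible_on E f} (ray_equiv E)"
proof (rule equivI)
  show "ray_equiv E \<subseteq> {f. irreducible_on E f} \<times> {f. irreducible_on E f}"
    by (auto simp: ray_equiv_def)
  show "refl_on {f. irreducible_on E f} (ray_equiv E)"
    by (auto simp: refl_on_def ray_equiv_def modular_on_def intro!: exI[of _ 1])
  show "sym (ray_equiv E)"
  proof (rule symI)
    fix f g assume "(f, g) \<in> ray_equiv E"
    then obtain c where *: "irreducible_on E f" "irreducible_on E g" "c > 0"
      "modular_on E (\<lambda>I. g I - c * f I)" by (auto simp: ray_equiv_def)
    have "modular_on E (\<lambda>I. f I - (1 / c) * g I)"
      using modular_on_lin[OF *(4) *(4), of "-1/c" 0] *(3)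
      by (simp add: diff_divide_distrib)
    with * show "(g, f) \<in> ray_equiv E"
      unfolding ray_equiv_def by (simp del: times_divide_eq_left) (metis zero_less_divide_1_iff)
  qed
  show "trans (ray_equiv E)"
  proof (rule transI)
    fix f g h assume "(f, g) \<in> ray_equiv E" "(g, h) \<in> ray_equiv E"
    then obtain c d where *: "irreducible_on E f" "irreducible_on E h" "c > 0" "d > 0"
      "modular_on E (\<lambda>I. g I - c * f I)" "modular_on E (\<lambda>I. h I - d * g I)"
      by (auto simp: ray_equiv_def)
    have "modular_on E (\<lambda>I. h I - (d * c) * f I)"
      using modular_on_lin[OF *(5) *(6), of d 1] by (simp add: algebra_simps)
    with * show "(f, h) \<in> ray_equiv E"
      unfolding ray_equiv_def by simp (metis mult_pos_pos)
  qed
qed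

lemma ex_dominated_scaling:
  fixes u v :: "'b \<Rightarrow> real"
  assumes "finite S" "\<And>x. x \<in> S \<Longrightarrow> u x \<ge> 0" "\<And>x. x \<in> S \<Longrightarrow> v x \<ge> 0"
    "\<And>x. x \<in> S \<Longrightarrow> u x = 0 \<Longrightarrow> v x = 0"
  shows "\<exists>e>0. \<forall>x\<in>S. e * v x \<le> u x"
  using assms
proof (induction S rule: finite_induct)
  case empty
  show ?case by (auto intro: exI[of _ 1])
next
  case (insert y S)
  then obtain e where e: "e > 0" "\<forall>x\<in>S. e * v x \<le> u x" by auto
  obtain d where d: "d > 0" "d * v y \<le> u y"
  proof (cases "v y = 0")
    case True
    then show ?thesis using insert.prems(1)[of y] that[of 1] by simp
  next
    case False
    then have "v y > 0" "u y > 0" using insert.prems(1,2,3)[of y] by force+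
    then show ?thesis using that[of "u y / v y"] by simp
  qed
  have "min d e * v x \<le> u x" if x: "x \<in> insert y S" for x
  proof -
    have "v x \<ge> 0" using insert.prems(2) x by auto
    then have "min d e * v x \<le> d * v x" "min d e * v x \<le> e * v x"
      by (auto intro!: mult_right_mono)
    then show ?thesis using x d(2) e(2) by force
  qed
  then show ?case using d(1) e(1) by (intro exI[of _ "min d e"]) auto
qed

text \<open>
  An irreducible function is determined up to equivalence and scaling by the pairs at which
  supermodularity holds with equality. Hence there are finitely many classes, and \<^const>\<open>card\<close>
  is their true number.
\<close>

lemma finite_irreducible_classes:
  assumes "finite E"
  shows "finite (irreducible_classes E)"
proof -
  define Df where
    "Df f = (\<lambda>P :: 'a set \<times> 'a set. f (fst P \<inter> snd P) + f (fst P \<union> snd P) - f (fst P) - f (snd P))"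
    for f :: "'a set \<Rightarrow> real"
  define T where "T f = {P \<in> Pow E \<times> Pow E. Df f P = 0}" for f
  have rel: "(f, g) \<in> ray_equiv E"
    if f: "irreducible_on E f" and g: "irreducible_on E g" and eq: "T f = T g" for f g
  proof -
    have sf: "supermodular_on E f" and sg: "supermodular_on E g"
      using f g by (auto simp: irreducible_on_def)
    have "\<exists>e>0. \<forall>P\<in>Pow E \<times> Pow E. e * Df g P \<le> Df f P"
    proof (rule ex_dominated_scaling)
      show "finite (Pow E \<times> Pow E)" using assms by simp
      show "Df f P \<ge> 0" "Df g P \<ge> 0" if "P \<in> Pow E \<times> Pow E" for P
        using sf sg that by (auto simp: Df_def supermodular_on_def algebra_simps)
      show "Df g P = 0" if "P \<in> Pow E \<times> Pow E" "Df f P = 0" for P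
        using eq that by (auto simp: T_def)
    qed
    then obtain e where e: "e > 0" "\<And>I J. I \<subseteq> E \<Longrightarrow> J \<subseteq> E \<Longrightarrow> e * Df g (I, J) \<le> Df f (I, J)"
      by auto
    have s1: "supermodular_on E (\<lambda>I. e * g I)"
      unfolding supermodular_on_def distrib_left[symmetric]
      using sg e(1) by (simp add: supermodular_on_def)
    have s2: "supermodular_on E (\<lambda>I. f I - e * g I)"
      unfolding supermodular_on_def
    proof (intro allI impI)
      fix I J assume "I \<subseteq> E" "J \<subseteq> E"
      from e(2)[OF this]
      show "f I - e * g I + (f J - e * g J) \<le> f (I \<inter> J) - e * g (I \<inter> J) + (f (I \<union> J) - e * g (I \<union> J))"
        by (simp add: Df_def algebra_simps)
    qed
    have "\<exists>c\<ge>0. equivalent_on E (\<lambda>I. e * g I) (\<lambda>I. c * f I)"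
      using f s1 s2 unfolding irreducible_on_def by force
    then obtain c where c: "c \<ge> 0" "modular_on E (\<lambda>I. e * g I - c * f I)"
      by (auto simp: equivalent_on_def)
    have m: "modular_on E (\<lambda>I. g I - (c / e) * f I)"
      using modular_on_lin[OF c(2) c(2), of "1 / e" 0] e(1) by (simp add: field_simps)
    have "c \<noteq> 0" using m g by (auto simp: irreducible_on_def)
    then show ?thesis using f g m e(1) c(1)
      unfolding ray_equiv_def by (auto intro!: exI[of _ "c / e"])
  qed
  let ?A = "{f. irreducible_on E f}"
  have "finite (T ` ?A)"
    by (rule finite_subset[of _ "Pow (Pow E \<times> Pow E)"]) (use assms in \<open>auto simp: T_def\<close>)
  moreover have "irreducible_classes E \<subseteq>
      (\<lambda>t. ray_equiv E `` {SOME f. irreducible_on E f \<and> T f = t}) ` (T ` ?A)"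
  proof
    fix C assume "C \<in> irreducible_classes E"
    then obtain f where f: "irreducible_on E f" "C = ray_equiv E `` {f}"
      by (auto simp: irreducible_classes_def quotient_def)
    let ?g = "SOME g. irreducible_on E g \<and> T g = T f"
    have "irreducible_on E ?g \<and> T ?g = T f"
      using someI[of "\<lambda>g. irreducible_on E g \<and> T g = T f" f] f(1) by simp
    then have "(f, ?g) \<in> ray_equiv E" using rel f(1) by simp
    then have "C = ray_equiv E `` {?g}"
      using equiv_class_eq[OF equiv_ray_equiv] f(2) by blast
    then show "C \<in> (\<lambda>t. ray_equiv E `` {SOME f. irreducible_on E f \<and> T f = t}) ` (T ` ?A)"
      using f(1) by blast
  qed
  ultimately show ?thesis by (meson finite_imageI finite_subset)
qed

end

theory Submission
  imports Defs "HOL-Probability.Characteristic_Functions" "HOL-Real_Asymp.Real_Asymp"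
begin

text \<open>
  For a family \<open>S\<close> of \<open>k\<close>-subsets of \<open>E\<close>, any two of which share at most \<open>k - 2\<close> elements, the sets
  in \<open>S\<close> are the circuit-hyperplanes of a sparse paving matroid of rank \<open>k\<close>. Up to the modular
  function \<open>I \<mapsto> |I|\<close>, the negative of its rank function is \<open>f\<^sub>S(I) = max(|I| - k, 0) + [I \<in> S]\<close>.
  In a decomposition \<open>f\<^sub>S = g\<^sub>1 + g\<^sub>2\<close>, each \<open>g\<^sub>i\<close> satisfies supermodularity with equality wherever
  \<open>f\<^sub>S\<close> does, and there are enough such pairs to make \<open>g\<^sub>i\<close> a multiple of \<open>f\<^sub>S\<close> once it vanishes on
  the sets with at most one element. Distinct \<open>S\<close> give inequivalent functions. By Graham and
  Sloane, for \<open>E = {1..n}\<close> the \<open>k\<close>-subsets with a suitable sum modulo \<open>n\<close> form such a family with at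
  least \<open>binomial n k / n\<close> members, and all its subfamilies may serve as \<open>S\<close>. With \<open>k = n div 2\<close>,
  the Wallis product gives the asymptotics.
\<close>

section \<open>Modular functions and pairs with equality\<close>

definition paving_fun :: "nat \<Rightarrow> 'a set set \<Rightarrow> 'a set \<Rightarrow> real" where
  "paving_fun k S I = real (card I - k) + of_bool (I \<in> S)"

definition tight :: "('a set \<Rightarrow> real) \<Rightarrow> 'a set \<Rightarrow> 'a set \<Rightarrow> bool" where
  "tight f I J \<longleftrightarrow> f (I \<inter> J) + f (I \<union> J) = f I + f J"

lemma modular_on_affine:
  assumes "finite E"
  shows "modular_on E (\<lambda>I. c + (\<Sum>i\<in>I. w i))"
proof -
  have "sum w (I \<inter> J) + sum w (I \<union> J) = sum w I + sum w J" if "I \<subseteq> E" "J \<subseteq> E" for I J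
    using sum.union_inter[of I J w] finite_subset[OF _ assms] that by (simp add: add.commute)
  then show ?thesis unfolding modular_on_def by (simp add: algebra_simps)
qed

text \<open>Serves as a test: for \<open>k \<ge> 2\<close> the paving functions vanish at all sets
  with at most one element, so a modular combination of them must be zero.\<close>

lemma modular_on_eq_zero:
  assumes "finite E" "modular_on E f" "f {} = 0" "\<And>i. i \<in> E \<Longrightarrow> f {i} = 0" "I \<subseteq> E"
  shows "f I = 0"
proof -
  have "finite I" using assms finite_subset by blast
  then show ?thesis using \<open>I \<subseteq> E\<close>
  proof (induction I rule: finite_induct)
    case (insert i I)
    have "f (I \<inter> {i}) + f (I \<union> {i}) = f I + f {i}"
      by (rule assms(2)[unfolded modular_on_def, rule_format]) (use insert.prems in auto)
    then show ?case using insert assms(3,4) by simp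
  qed (simp add: assms(3))
qed

text \<open>The supermodularity defects of \<open>g1\<close> and \<open>g2\<close> are nonnegative
  and add up to that of \<open>f\<close>.\<close>

lemma tight_summand:
  assumes "supermodular_on E g1" "supermodular_on E g2" "\<And>I. I \<subseteq> E \<Longrightarrow> f I = g1 I + g2 I"
    "I \<subseteq> E" "J \<subseteq> E" "tight f I J"
  shows "tight g1 I J"
proof -
  have "g1 I + g1 J \<le> g1 (I \<inter> J) + g1 (I \<union> J)" "g2 I + g2 J \<le> g2 (I \<inter> J) + g2 (I \<union> J)"
    using assms(1,2,4,5) by (auto simp: supermodular_on_def)
  moreover have "I \<inter> J \<subseteq> E" "I \<union> J \<subseteq> E" using assms(4,5) by auto
  ultimately show ?thesis using assms(3-6) by (simp add: tight_def)
qed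

section \<open>Sparse paving families and supermodularity\<close>

text \<open>\<open>k_ge\<close> makes \<open>paving_fun k S\<close> vanish at singletons;
  \<open>card_E\<close> leaves \<open>k + 1\<close> elements outside any two, the room needed in
  \<open>obtain_non_members\<close>.\<close>

locale paving_family =
  fixes E :: "'a set" and k :: nat and S :: "'a set set"
  assumes finite_E: "finite E"
    and k_ge: "2 \<le> k"
    and card_E: "k + 3 \<le> card E"
    and S_subset: "I \<in> S \<Longrightarrow> I \<subseteq> E"
    and S_card: "I \<in> S \<Longrightarrow> card I = k"
    and S_sep: "I \<in> S \<Longrightarrow> J \<in> S \<Longrightarrow> I \<noteq> J \<Longrightarrow> card (I \<inter> J) + 2 \<le> k"
begin

abbreviation "f \<equiv> paving_fun k S"

lemma fin: "I \<subseteq> E \<Longrightarrow> finite I"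
  using finite_E finite_subset by blast

text \<open>Two different one-element extensions of \<open>J\<close> meet exactly in
  \<open>J\<close>, which has \<open>k - 1\<close> elements, one too many for
  \<open>S_sep\<close>.\<close>

lemma S_insert_unique:
  assumes "insert i J \<in> S" "insert j J \<in> S" "i \<notin> J" "j \<notin> J"
  shows "i = j"
proof (rule ccontr)
  assume "i \<noteq> j"
  then have "insert i J \<noteq> insert j J" using assms(3) by blast
  from S_sep[OF assms(1,2) this] have "card (insert i J \<inter> insert j J) + 2 \<le> k" .
  moreover have "insert i J \<inter> insert j J = J" using \<open>i \<noteq> j\<close> assms(3,4) by blast
  moreover have "finite J" using S_subset[OF assms(1)] fin by blast
  then have "k = Suc (card J)" using S_card[OF assms(1)] assms(3) by simp
  ultimately show False by simp
qed

lemma paving_fun_low: "I \<subseteq> E \<Longrightarrow> card I \<le> k \<Longrightarrow> I \<notin> S \<Longrightarrow> f I = 0"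
  by (simp add: paving_fun_def)

lemma paving_fun_high: "k < card I \<Longrightarrow> f I = real (card I) - real k"
  using S_card by (auto simp: paving_fun_def)

lemma paving_fun_mem: "I \<in> S \<Longrightarrow> f I = 1"
  using S_card by (simp add: paving_fun_def)

lemma supermodular: "supermodular_on E f"
  unfolding supermodular_on_def
proof (intro allI impI)
  fix I J assume I: "I \<subseteq> E" and J: "J \<subseteq> E"
  \<comment> \<open>Nested pairs give equality, and by symmetry only one of the two mixed membership
    cases has to be treated.\<close>
  have *: "f I + f J \<le> f (I \<inter> J) + f (I \<union> J)"
    if IJ: "I \<subseteq> E" "J \<subseteq> E" "\<not> I \<subseteq> J" "\<not> J \<subseteq> I" "I \<in> S \<or> J \<notin> S" for I J
  proof -
    have finI: "finite I" "finite J" using IJ fin by auto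
    have sum: "card (I \<inter> J) + card (I \<union> J) = card I + card J"
      using card_Un_Int[OF finI] by simp
    have lt: "card (I \<inter> J) < card I" "card (I \<inter> J) < card J"
      "card I < card (I \<union> J)" "card J < card (I \<union> J)"
      using IJ finI by (auto intro!: psubset_card_mono)
    consider "I \<notin> S" "J \<notin> S" | "I \<in> S" "J \<notin> S" | "I \<in> S" "J \<in> S" using IJ by blast
    then show ?thesis
    proof cases
      case 1
      \<comment> \<open>Convexity of \<open>max (t - k) 0\<close>: both sides have the same sum of
        cardinalities, and intersection and union are further apart.\<close>
      have "(card I - k) + (card J - k) \<le> (card (I \<inter> J) - k) + (card (I \<union> J) - k)"
        using sum lt by arith
      then have "real (card I - k) + real (card J - k)
          \<le> real (card (I \<inter> J) - k) + real (card (I \<union> J) - k)"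
        unfolding of_nat_add[symmetric] of_nat_le_iff .
      then show ?thesis using 1 by (simp add: paving_fun_def)
    next
      case 2
      have "card I = k" using 2 S_card by blast
      \<comment> \<open>The extra 1 at \<open>I\<close> is paid for by the union, which is larger
        than \<open>J\<close> and has more than \<open>k\<close> elements.\<close>
      then have "1 + (card J - k) \<le> (card (I \<union> J) - k)"
        using sum lt by linarith
      then have "1 + real (card J - k) \<le> real (card (I \<union> J) - k)"
        by linarith
      moreover have "f I = 1" "f J = real (card J - k)" "0 \<le> f (I \<inter> J)"
        "real (card (I \<union> J) - k) \<le> f (I \<union> J)"
        using 2 \<open>card I = k\<close> by (auto simp: paving_fun_def)
      ultimately show ?thesis by linarith
    next
      case 3
      have "card I = k" "card J = k" "card (I \<inter> J) + 2 \<le> k" using 3 S_card S_sep IJ by auto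
      then have "2 \<le> card (I \<union> J) - k" using sum by linarith
      then have "2 \<le> real (card (I \<union> J) - k)" by linarith
      moreover have "f I = 1" "f J = 1" "0 \<le> f (I \<inter> J)"
        "real (card (I \<union> J) - k) \<le> f (I \<union> J)"
        using 3 paving_fun_mem by (auto simp: paving_fun_def)
      ultimately show ?thesis by linarith
    qed
  qed
  consider "I \<subseteq> J" | "J \<subseteq> I" | "\<not> I \<subseteq> J" "\<not> J \<subseteq> I" by blast
  then show "f I + f J \<le> f (I \<inter> J) + f (I \<union> J)"
  proof cases
    case 3
    then show ?thesis
      using *[OF I J 3] *[OF J I 3(2,1)] by (auto simp: Int_commute Un_commute add.commute)
  qed (simp_all add: Int_absorb1 Int_absorb2 Un_absorb1 Un_absorb2)
qed

section \<open>Irreducibility\<close>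

text \<open>Fix a \<open>(k - 2)\<close>-set \<open>A\<close> avoiding \<open>i\<close> and
  \<open>j\<close>, and three candidates for one more element \<open>u\<close>. By
  \<open>S_insert_unique\<close>, each of \<open>i\<close> and \<open>j\<close> excludes at most one
  candidate, so one of the three survives.\<close>

lemma obtain_non_members:
  assumes "i \<in> E" "j \<in> E" "i \<noteq> j"
  obtains J where "J \<subseteq> E" "card J = k - 1" "i \<notin> J" "j \<notin> J" "insert i J \<notin> S" "insert j J \<notin> S"
proof -
  have "card (E - {i, j}) = card E - 2" using assms finite_E by (simp add: card_Diff_subset)
  then have "k + 1 \<le> card (E - {i, j})" using card_E by simp
  then obtain T where T: "T \<subseteq> E - {i, j}" "card T = k + 1"
    by (rule obtain_subset_with_card_n)
  then have "k - 2 \<le> card T" by simp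
  then obtain A where A: "A \<subseteq> T" "card A = k - 2"
    by (rule obtain_subset_with_card_n)
  have "finite A" "finite T" using A T finite_E by (auto intro: finite_subset)
  then have "card (T - A) = 3" using A T k_ge by (simp add: card_Diff_subset)
  then obtain x y z where xyz: "T - A = {x, y, z}" "x \<noteq> y" "x \<noteq> z" "y \<noteq> z"
    by (auto simp: card_3_iff)
  have uniq: "u = v"
    if "insert l (insert u A) \<in> S" "insert l (insert v A) \<in> S"
      "u \<in> T - A" "v \<in> T - A" "l = i \<or> l = j" for u v l
    using S_insert_unique[of u "insert l A" v] that T by (auto simp: insert_commute)
  have "\<exists>u\<in>{x, y, z}. insert i (insert u A) \<notin> S \<and> insert j (insert u A) \<notin> S"
    using uniq xyz by (metis insertCI)
  then obtain u where u: "u \<in> T - A" "insert i (insert u A) \<notin> S" "insert j (insert u A) \<notin> S"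
    using xyz by auto
  show thesis
  proof
    show "insert u A \<subseteq> E" "i \<notin> insert u A" "j \<notin> insert u A" using u(1) A T by auto
    show "card (insert u A) = k - 1" using u A \<open>finite A\<close> k_ge by simp
  qed (use u in auto)
qed

text \<open>The tight pairs determine \<open>h\<close> level by level: it vanishes up to size
  \<open>k\<close> off \<open>S\<close>, above that each new element adds one and the same amount
  \<open>c\<close>, and the members of \<open>S\<close> get \<open>c\<close> as well.
  Supermodularity of \<open>h\<close> gives the sign of \<open>c\<close>.\<close>

lemma proportional:
  assumes super: "supermodular_on E h" and h0: "h {} = 0" and h1: "\<And>i. i \<in> E \<Longrightarrow> h {i} = 0"
    and tight: "\<And>I J. I \<subseteq> E \<Longrightarrow> J \<subseteq> E \<Longrightarrow> tight f I J \<Longrightarrow> tight h I J"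
  shows "\<exists>c\<ge>0. \<forall>I\<subseteq>E. h I = c * f I"
proof -
  have low_lt: "h I = 0" if "I \<subseteq> E" "card I < k" for I
  proof -
    from that(1) have "finite I" by (rule fin)
    then show ?thesis using that
    proof (induction I rule: finite_induct)
      case (insert i I)
      \<comment> \<open>Sets with fewer than \<open>k\<close> elements are independent, so
        \<open>f\<close> is zero at all four sets of the pair \<open>I\<close>,
        \<open>{i}\<close>.\<close>
      have "f I = 0" "f {i} = 0" "f {} = 0" "f (insert i I) = 0"
        using insert k_ge S_card[of I] S_card[of "{i}"] S_card[of "{}"] S_card[of "insert i I"]
        by (auto intro!: paving_fun_low)
      then have "tight h I {i}" using insert by (intro tight) (auto simp: tight_def)
      then show ?case using insert h0 h1 by (auto simp: tight_def)
    qed (simp add: h0)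
  qed
  have low: "h I = 0" if I: "I \<subseteq> E" "card I = k" "I \<notin> S" for I
  proof -
    obtain i where i: "i \<in> I" using I k_ge by fastforce
    let ?J = "I - {i}"
    have J: "card ?J < k" "?J \<subseteq> E" "insert i ?J = I" using i I k_ge by auto
    have "f ?J = 0" "f {i} = 0" "f {} = 0" "f I = 0"
      using i I J k_ge S_card[of ?J] S_card[of "{i}"] S_card[of "{}"]
      by (auto simp: paving_fun_def)
    then have "tight h ?J {i}" using J i I by (intro tight) (auto simp: tight_def insert_absorb)
    then show ?thesis using low_lt[OF J(2,1)] h0 h1 i I J by (auto simp: tight_def insert_absorb)
  qed
  \<comment> \<open>Above size \<open>k\<close>, \<open>f\<close> is affine in the cardinality, so
    pairs whose intersection has more than \<open>k\<close> elements are tight. Comparison with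
    \<open>E - {i}\<close> shows that the increment at \<open>i\<close> is the same for all such
    sets.\<close>
  define w where "w i = h E - h (E - {i})" for i
  have step: "h (insert i M) = h M + w i" if M: "M \<subseteq> E" "i \<in> E" "i \<notin> M" "k < card M" for M i
  proof -
    have eq: "insert i M \<inter> (E - {i}) = M" "insert i M \<union> (E - {i}) = E" using M by auto
    have "card (insert i M) = card M + 1" "card (E - {i}) = card E - 1"
      using M fin finite_E by auto
    then have "tight f (insert i M) (E - {i})"
      unfolding tight_def eq using M card_E by (subst (1 2 3 4) paving_fun_high) auto
    then have "tight h (insert i M) (E - {i})" using M by (intro tight) auto
    then show ?thesis unfolding tight_def eq w_def by simp
  qed
  \<comment> \<open>\<open>step\<close> requires more than \<open>k\<close> elements. A second new
    point \<open>b\<close> carries it down to nonmembers of size exactly \<open>k\<close>: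
    \<open>f\<close> takes the values 0, 1, 1, 2 on the square spanned by \<open>a\<close> and
    \<open>b\<close> over \<open>I\<close>.\<close>
  have level: "h (insert a I) = w a" if I: "I \<subseteq> E" "card I = k" "I \<notin> S" "a \<in> E" "a \<notin> I" for I a
  proof -
    have finI: "finite I" using I fin by blast
    have "card (insert a I) = k + 1" using I finI by simp
    then have "\<not> E \<subseteq> insert a I" using card_mono[of "insert a I" E] finI card_E by auto
    then obtain b where b: "b \<in> E" "b \<notin> I" "b \<noteq> a" by auto
    have eq: "insert a I \<inter> insert b I = I" "insert a I \<union> insert b I = insert a (insert b I)"
      using b I by auto
    have c: "card (insert b I) = k + 1" "card (insert a (insert b I)) = k + 2"
      using I b finI by auto
    have "f (insert a I) = 1" "f (insert b I) = 1" "f (insert a (insert b I)) = 2" "f I = 0"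
      using c \<open>card (insert a I) = k + 1\<close> I
      by (auto simp: paving_fun_high paving_fun_low)
    then have "tight f (insert a I) (insert b I)" unfolding tight_def eq by simp
    then have "tight h (insert a I) (insert b I)" using I b by (intro tight) auto
    then have "h (insert a (insert b I)) = h (insert a I) + h (insert b I)"
      unfolding tight_def eq using low[OF I(1-3)] by simp
    moreover have "h (insert a (insert b I)) = h (insert b I) + w a"
      using step[of "insert b I" a] I b c by simp
    ultimately show ?thesis by simp
  qed
  have w_eq: "w i = w j" if ij: "i \<in> E" "j \<in> E" for i j
  proof (cases "i = j")
    case False
    obtain J where J: "J \<subseteq> E" "card J = k - 1" "i \<notin> J" "j \<notin> J" "insert i J \<notin> S" "insert j J \<notin> S"
      using obtain_non_members[OF ij False] .
    have "card (insert i J) = k" "card (insert j J) = k" using J fin k_ge by auto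
    \<comment> \<open>One set of size \<open>k + 1\<close> is reached from two nonmembers, once by
      adding \<open>j\<close> and once by adding \<open>i\<close>.\<close>
    then have "h (insert j (insert i J)) = w j" "h (insert i (insert j J)) = w i"
      using J ij False by (auto intro!: level)
    then show ?thesis by (simp add: insert_commute)
  qed simp
  obtain e where e: "e \<in> E" using card_E by fastforce
  define c where "c = w e"
  have w_c: "w i = c" if "i \<in> E" for i unfolding c_def using w_eq that e by blast
  have level_c: "h L = c" if L: "L \<subseteq> E" "card L = k + 1" for L
  proof -
    have "2 \<le> card L" using L k_ge by simp
    then obtain D where "D \<subseteq> L" "card D = 2" by (rule obtain_subset_with_card_n)
    then obtain x y where xy: "x \<in> L" "y \<in> L" "x \<noteq> y" by (auto simp: card_2_iff)
    \<comment> \<open>Both sets extend \<open>L - {x, y}\<close> by one element, so at most one of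
      them lies in \<open>S\<close> and \<open>level\<close> applies to the other.\<close>
    have "L - {x} = insert y (L - {x, y})" "L - {y} = insert x (L - {x, y})" using xy by auto
    then have "L - {x} \<notin> S \<or> L - {y} \<notin> S"
      using S_insert_unique[of y "L - {x, y}" x] xy by auto
    then obtain a where a: "a \<in> L" "L - {a} \<notin> S" using xy by blast
    have "h (insert a (L - {a})) = w a" using a L fin by (intro level) auto
    then show ?thesis using a L w_c by (auto simp: insert_absorb)
  qed
  have high: "h M = c * real m" if "M \<subseteq> E" "card M = k + m" "m > 0" for M m
    using that
  proof (induction m arbitrary: M)
    case (Suc m)
    show ?case
    proof (cases "m = 0")
      case True
      then show ?thesis using level_c Suc by simp
    next
      case False
      obtain i where i: "i \<in> M" using Suc by fastforce
      have "h (insert i (M - {i})) = h (M - {i}) + w i"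
        using Suc i False fin by (intro step) auto
      moreover have "h (M - {i}) = c * real m" using Suc i False fin by (intro Suc.IH) auto
      ultimately show ?thesis using i Suc w_c by (auto simp: insert_absorb algebra_simps)
    qed
  qed simp
  have mem: "h K = c" if K: "K \<in> S" for K
  proof -
    have K': "K \<subseteq> E" "card K = k" "finite K" using K S_card S_subset fin by auto
    then have "K \<noteq> {}" "\<not> E \<subseteq> K" using k_ge card_E card_mono[of K E] by auto
    then obtain x a where xa: "x \<in> K" "a \<in> E" "a \<notin> K" by blast
    \<comment> \<open>Exchanging \<open>x\<close> for \<open>a\<close> gives a nonmember. On this
      pair \<open>f\<close> is 1 and 0, on its intersection and union 0 and 1, so the pair is tight
      and \<open>h K\<close> is the only value not yet known.\<close>
    let ?I = "K - {x}"
    have "insert a ?I \<notin> S" using S_insert_unique[of a ?I x] K xa by (auto simp: insert_absorb)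
    have c: "card ?I = k - 1" "card (insert a ?I) = k" "card (insert a K) = k + 1"
      using xa K' k_ge by auto
    have eq: "K \<inter> insert a ?I = ?I" "K \<union> insert a ?I = insert a K" using xa by auto
    have "?I \<notin> S" using c k_ge S_card by fastforce
    have "f ?I = 0" "f (insert a ?I) = 0"
      using c K' xa \<open>?I \<notin> S\<close> \<open>insert a ?I \<notin> S\<close> by (intro paving_fun_low; auto)+
    moreover have "f (insert a K) = 1" "f K = 1"
      using c K by (simp_all add: paving_fun_high paving_fun_mem)
    ultimately have "tight f K (insert a ?I)" unfolding tight_def eq by simp
    then have "tight h K (insert a ?I)" using K' xa by (intro tight) auto
    moreover have "h ?I = 0" using c K' k_ge by (intro low_lt) auto
    moreover have "h (insert a ?I) = 0"
      using c K' xa \<open>insert a ?I \<notin> S\<close> by (intro low) auto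
    moreover have "h (insert a K) = c" using c K' xa by (intro level_c) auto
    ultimately show ?thesis unfolding tight_def eq by simp
  qed
  have eq: "h I = c * f I" if I: "I \<subseteq> E" for I
  proof -
    consider "card I < k" | "card I = k" "I \<notin> S" | "I \<in> S" | "k < card I" by linarith
    then show ?thesis
    proof cases
      case 1
      then have "f I = 0" using I S_card[of I] by (intro paving_fun_low) auto
      then show ?thesis using low_lt I 1 by simp
    next
      case 4
      then show ?thesis using high[of I "card I - k"] I
        by (simp add: paving_fun_high of_nat_diff)
    qed (use I low mem in \<open>auto simp: paving_fun_low paving_fun_mem\<close>)
  qed
  \<comment> \<open>For the sign of \<open>c\<close>, add \<open>i\<close> to a nonmember of size
    \<open>k\<close>: \<open>h\<close> goes from 0 to \<open>c\<close>, and supermodularity with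
    \<open>{i}\<close> forbids a decrease.\<close>
  have "\<not> E \<subseteq> {e}" using card_mono[of "{e}" E] card_E by auto
  then obtain i where "i \<in> E" "i \<noteq> e" by blast
  then obtain J where J: "J \<subseteq> E" "card J = k - 1" "e \<notin> J" "i \<notin> J" "insert e J \<notin> S" "insert i J \<notin> S"
    using obtain_non_members[OF e] by metis
  have "card (insert e J) = k" "card (insert i (insert e J)) = k + 1"
    using J fin k_ge \<open>i \<noteq> e\<close> by auto
  moreover have "h (insert e J) + h {i} \<le> h (insert e J \<inter> {i}) + h (insert e J \<union> {i})"
    using super J(1) e \<open>i \<in> E\<close> unfolding supermodular_on_def by blast
  moreover have "insert e J \<inter> {i} = {}" using J \<open>i \<noteq> e\<close> by auto
  ultimately have "c \<ge> 0"
    using low[of "insert e J"] level_c[of "insert i (insert e J)"] J e \<open>i \<in> E\<close> h0 h1 by simp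
  then show ?thesis using eq by blast
qed

lemma summand_equivalent:
  assumes g: "supermodular_on E g1" "supermodular_on E g2" "\<And>I. I \<subseteq> E \<Longrightarrow> f I = g1 I + g2 I"
  shows "\<exists>c\<ge>0. equivalent_on E g1 (\<lambda>I. c * f I)"
proof -
  \<comment> \<open>The modular function that agrees with \<open>g1\<close> on the sets with at most
    one element; subtracting it gives the normalisation that \<open>proportional\<close> asks
    for.\<close>
  define m where "m I = g1 {} + (\<Sum>i\<in>I. g1 {i} - g1 {})" for I
  have m: "m (I \<inter> J) + m (I \<union> J) = m I + m J" if "I \<subseteq> E" "J \<subseteq> E" for I J
    using modular_on_affine[OF finite_E] that unfolding m_def modular_on_def by blast
  have "\<exists>c\<ge>0. \<forall>I\<subseteq>E. g1 I - m I = c * f I"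
  proof (rule proportional)
    show "supermodular_on E (\<lambda>I. g1 I - m I)"
      using g(1) m unfolding supermodular_on_def by (smt (verit))
    show "tight (\<lambda>I. g1 I - m I) I J" if "I \<subseteq> E" "J \<subseteq> E" "tight f I J" for I J
      using tight_summand[OF g that] m[OF that(1,2)] by (simp add: tight_def)
  qed (auto simp: m_def)
  then obtain c where c: "c \<ge> 0" "\<And>I. I \<subseteq> E \<Longrightarrow> g1 I - c * f I = m I"
    by (auto simp: algebra_simps)
  have "equivalent_on E g1 (\<lambda>I. c * f I)"
    unfolding equivalent_on_def modular_on_def using c(2) m by (simp add: le_infI1)
  then show ?thesis using c(1) by blast
qed

lemma paving_fun_le_1:
  assumes "card I \<le> 1"
  shows "f I = 0"
  using assms k_ge S_card[of I] by (auto simp: paving_fun_def)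

lemma paving_fun_E: "f E = real (card E - k)"
  using S_card[of E] card_E by (auto simp: paving_fun_def)

lemma irreducible: "irreducible_on E f"
  unfolding irreducible_on_def
proof (intro conjI allI impI)
  show "\<not> modular_on E f"
  proof
    assume "modular_on E f"
    then have "f E = 0"
      by (rule modular_on_eq_zero[OF finite_E]) (auto simp: paving_fun_le_1)
    then show False using paving_fun_E card_E by simp
  qed
next
  fix g1 g2
  assume g: "supermodular_on E g1" "supermodular_on E g2" "\<forall>I\<subseteq>E. f I = g1 I + g2 I"
  then show "\<exists>c1\<ge>0. equivalent_on E g1 (\<lambda>I. c1 * f I)" by (intro summand_equivalent[of g1 g2]) auto
  show "\<exists>c2\<ge>0. equivalent_on E g2 (\<lambda>I. c2 * f I)"
    using g by (intro summand_equivalent[of g2 g1]) auto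
qed (fact supermodular)

end

section \<open>Counting classes by subfamilies\<close>

lemma paving_family_subset:
  assumes "paving_family E k C" "S \<subseteq> C"
  shows "paving_family E k S"
proof -
  interpret paving_family E k C by fact
  show ?thesis
    by unfold_locales (use finite_E k_ge card_E S_subset S_card S_sep subsetD[OF assms(2)] in simp_all)
qed

text \<open>Both functions vanish at sets with at most one element, so the modular difference is
  zero. Their common positive value at \<open>E\<close> forces \<open>c = 1\<close>, and then
  membership can be read off.\<close>

lemma paving_fun_inequivalent:
  assumes S: "paving_family E k S" and T: "paving_family E k T"
    and rel: "(paving_fun k S, paving_fun k T) \<in> ray_equiv E"
  shows "S = T"
proof -
  interpret S: paving_family E k S by fact
  interpret T: paving_family E k T by fact
  obtain c where "modular_on E (\<lambda>I. T.f I - c * S.f I)" using rel by (auto simp: ray_equiv_def)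
  then have eq: "T.f I - c * S.f I = 0" if "I \<subseteq> E" for I
    by (rule modular_on_eq_zero[OF S.finite_E])
      (use that in \<open>auto simp: S.paving_fun_le_1 T.paving_fun_le_1\<close>)
  have "c = 1" using eq[of E] S.card_E by (simp add: S.paving_fun_E T.paving_fun_E)
  then have "I \<in> S \<longleftrightarrow> I \<in> T" if "I \<subseteq> E" for I
    using eq[OF that] by (simp add: paving_fun_def of_bool_def split: if_splits)
  then show ?thesis using S.S_subset T.S_subset by blast
qed

lemma card_irreducible_classes_ge:
  assumes "paving_family E k C"
  shows "2 ^ card C \<le> card (irreducible_classes E)"
proof -
  interpret paving_family E k C by fact
  have sub: "paving_family E k S" if "S \<in> Pow C" for S
    using paving_family_subset assms that by blast
  define q where "q S = ray_equiv E `` {paving_fun k S}" for S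
  have "inj_on q (Pow C)"
  proof (rule inj_onI)
    fix S T assume ST: "S \<in> Pow C" "T \<in> Pow C" "q S = q T"
    have "irreducible_on E (paving_fun k T)" using paving_family.irreducible sub ST by blast
    then have "(paving_fun k S, paving_fun k T) \<in> ray_equiv E"
      using ST(3) equiv_class_self[OF equiv_ray_equiv, of "paving_fun k T"]
      by (auto simp: q_def)
    then show "S = T" using paving_fun_inequivalent sub ST by blast
  qed
  moreover have "q ` Pow C \<subseteq> irreducible_classes E"
    using paving_family.irreducible[OF sub]
    by (auto simp: q_def irreducible_classes_def intro!: quotientI)
  \<comment> \<open>Finiteness of the set of classes matters, since \<open>card\<close> of an
    infinite set is 0.\<close>
  ultimately have "card (Pow C) \<le> card (irreducible_classes E)"
    using card_inj_on_le finite_irreducible_classes[OF finite_E] by blast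
  moreover have "finite C" using S_subset finite_E by (auto intro!: finite_subset[of C "Pow E"])
  ultimately show ?thesis by (simp add: card_Pow)
qed

section \<open>The Graham-Sloane construction\<close>

text \<open>If two \<open>k\<close>-sets share \<open>k - 1\<close> elements, their sums differ by
  \<open>i - j\<close> with distinct \<open>i\<close>, \<open>j\<close> in \<open>{1..n}\<close>,
  which is nonzero modulo \<open>n\<close>. Hence each residue class of sums is a valid
  family.\<close>

lemma ex_large_paving_family:
  fixes n k :: nat
  assumes "2 \<le> k" "k + 3 \<le> n"
  shows "\<exists>C. paving_family {1..n} k C \<and> n choose k \<le> n * card C"
proof -
  define P where "P = {I. I \<subseteq> {1..n} \<and> card I = k}"
  define C where "C r = {I \<in> P. \<Sum>I mod n = r}" for r
  have family: "paving_family {1..n} k (C r)" for r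
  proof
    fix I J assume IJ: "I \<in> C r" "J \<in> C r" "I \<noteq> J"
    then have sub: "I \<subseteq> {1..n}" "J \<subseteq> {1..n}" and c: "card I = k" "card J = k"
      and eq: "\<Sum>I mod n = \<Sum>J mod n"
      by (simp_all add: C_def P_def)
    have fin: "finite I" "finite J" using sub[THEN finite_subset] by simp_all
    show "card (I \<inter> J) + 2 \<le> k"
    proof (rule ccontr)
      assume "\<not> card (I \<inter> J) + 2 \<le> k"
      moreover have "\<not> I \<subseteq> J" using card_subset_eq[OF fin(2), of I] c IJ(3) by auto
      then have "card (I \<inter> J) < k" unfolding c(1)[symmetric] by (intro psubset_card_mono fin) auto
      ultimately have "card (I \<inter> J) = k - 1" by linarith
      moreover have "card (I - J) = k - card (I \<inter> J)" "card (J - I) = k - card (I \<inter> J)"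
        using c fin by (simp_all add: card_Diff_subset_Int Int_commute)
      ultimately have "card (I - J) = 1" "card (J - I) = 1" using assms by auto
      then obtain i j where ij: "I - J = {i}" "J - I = {j}" by (auto simp: card_1_singleton_iff)
      have "\<Sum>I = \<Sum>(I \<inter> J) + i" "\<Sum>J = \<Sum>(I \<inter> J) + j"
        using sum.Int_Diff[OF fin(1), of "\<lambda>x. x" J] sum.Int_Diff[OF fin(2), of "\<lambda>x. x" I] ij
        by (simp_all add: Int_commute)
      then have "(\<Sum>(I \<inter> J) + i) mod n = (\<Sum>(I \<inter> J) + j) mod n"
        using eq by simp
      \<comment> \<open>Integers are used because \<open>i - j\<close> would be truncated on the
        naturals.\<close>
      then have "int (\<Sum>(I \<inter> J) + i) mod int n = int (\<Sum>(I \<inter> J) + j) mod int n"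
        by (simp only: of_nat_mod[symmetric])
      then have "int n dvd int i - int j" by (simp add: mod_eq_dvd_iff)
      moreover have "i \<in> {1..n}" "j \<in> {1..n}" "i \<noteq> j" using ij sub by auto
      ultimately show False
        using dvd_imp_le_int[of "int i - int j" "int n"] by auto
    qed
  qed (use assms in \<open>auto simp: C_def P_def\<close>)
  have "n > 0" using assms by simp
  \<comment> \<open>Averaging: the \<open>n\<close> residue classes cover all
    \<open>k\<close>-subsets.\<close>
  have "\<exists>r<n. n choose k \<le> n * card (C r)"
  proof (rule ccontr)
    assume *: "\<not> (\<exists>r<n. n choose k \<le> n * card (C r))"
    have "P = (\<Union>r<n. C r)" using \<open>n > 0\<close> by (auto simp: C_def)
    then have "card P \<le> (\<Sum>r<n. card (C r))" using card_UN_le[of "{..<n}" C] by simp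
    then have "n * card P \<le> (\<Sum>r<n. n * card (C r))"
      by (simp add: sum_distrib_left[symmetric])
    also have "\<dots> < (\<Sum>r<n. n choose k)"
      using * \<open>n > 0\<close> by (intro sum_strict_mono) auto
    also have "\<dots> = n * card P" using n_subsets[of "{1..n}" k] by (simp add: P_def)
    finally show False by simp
  qed
  then show ?thesis using family by blast
qed

section \<open>Asymptotics of the middle binomial coefficient\<close>

text \<open>The normalised central binomial coefficient is the product of
  \<open>(2 * k - 1) / (2 * k)\<close>. Its square times the Wallis partial product telescopes to
  \<open>1 / (2 * m + 1)\<close>.\<close>

lemma central_binomial_wallis:
  "((2 * m choose m) / 4 ^ m)\<^sup>2 * (2 * real m + 1) * (\<Prod>k=1..m. (4 * real k^2) / (4 * real k^2 - 1)) = 1"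
proof (induction m)
  case (Suc m)
  let ?P = "\<lambda>m. (\<Prod>k=1..m. (4 * real k^2) / (4 * real k^2 - 1))"
  let ?c = "real (2 * m choose m)" 
  have "Suc m * (2 * Suc m choose Suc m) = 2 * (2 * m + 1) * (2 * m choose m)"
  proof -
    have "Suc m * (2 * Suc m choose Suc m) = (2 * m + 2) * (2 * m + 1 choose m)"
      using Suc_times_binomial[of m "2 * m + 1"] by simp
    moreover have "Suc m * (2 * m + 1 choose m) = (2 * m + 1) * (2 * m choose m)"
      using Suc_times_binomial[of m "2 * m"] binomial_symmetric[of m "2 * m + 1"] by simp
    ultimately show ?thesis by simp
  qed
  then have "real (Suc m) * real (2 * Suc m choose Suc m) = 2 * (2 * real m + 1) * ?c"
    by (metis (mono_tags) of_nat_mult of_nat_add of_nat_numeral of_nat_1)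
  then have c: "real (2 * Suc m choose Suc m) = 2 * (2 * real m + 1) * ?c / (real m + 1)"
    by (simp add: field_simps)
  have "(real m + 1)\<^sup>2 * 4 - 1 = (2 * real m + 1) * (2 * real m + 3)"
    by (simp add: algebra_simps power2_eq_square)
  then have P: "?P (Suc m) = ?P m * (4 * (real m + 1)\<^sup>2 / ((2 * real m + 1) * (2 * real m + 3)))"
    by (simp add: add.commute mult.commute)
  \<comment> \<open>Here \<open>x\<close>, \<open>c\<close>, \<open>q\<close>, \<open>p\<close>
    stand for \<open>m\<close>, the binomial coefficient, \<open>4 ^ m\<close> and the Wallis
    product, which reduces the induction step to an identity of rational functions.\<close>
  have *: "(2 * (2 * x + 1) * c / (x + 1) / (4 * q))\<^sup>2 * (2 * x + 3)
      * (p * (4 * (x + 1)\<^sup>2 / ((2 * x + 1) * (2 * x + 3)))) = (c / q)\<^sup>2 * (2 * x + 1) * p"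
    if "x \<ge> 0" "q > 0" for x c q p :: real
  proof -
    have "x + 1 \<noteq> 0" "2 * x + 1 \<noteq> 0" "2 * x + 3 \<noteq> 0" using that by auto
    then show ?thesis using that by (simp add: divide_simps power2_eq_square) (simp add: algebra_simps)
  qed
  show ?case
    unfolding c P using Suc.IH *[of "real m" "4 ^ m" ?c "?P m"] by (simp add: algebra_simps)
qed simp

lemma central_binomial_even:
  "(\<lambda>m. (2 * m choose m) / 4 ^ m * sqrt (2 * real m + 1)) \<longlonglongrightarrow> sqrt (2 / pi)"
proof -
  let ?P = "\<lambda>m. (\<Prod>k=1..m. (4 * real k^2) / (4 * real k^2 - 1))"
  have "(2 * m choose m) / 4 ^ m * sqrt (2 * real m + 1) = sqrt (1 / ?P m)" for m
  proof -
    have "a = 1 / p" if "a * p = 1" for a p :: real using that by (cases "p = 0") (auto simp: field_simps)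
    from this[OF central_binomial_wallis[of m]]
    have "1 / ?P m = ((2 * m choose m) / 4 ^ m)\<^sup>2 * (2 * real m + 1)" by (rule sym)
    then show ?thesis by (simp only: real_sqrt_mult) simp
  qed
  moreover have "(\<lambda>m. sqrt (1 / ?P m)) \<longlonglongrightarrow> sqrt (1 / (pi / 2))"
    by (intro tendsto_intros wallis) simp
  ultimately show ?thesis by simp
qed

lemma middle_binomial_asymptotics:
  "(\<lambda>n. (n choose (n div 2)) * sqrt n / 2 ^ n) \<longlonglongrightarrow> sqrt (2 / pi)"
proof (rule limseq_even_odd)
  let ?x = "\<lambda>m. (2 * m choose m) / 4 ^ m * sqrt (2 * real m + 1)"
  \<comment> \<open>This factor turns \<open>sqrt (2 * real m + 1)\<close> into
    \<open>sqrt n\<close> for \<open>n = 2 * m\<close>.\<close>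
  have "(\<lambda>m. sqrt (2 * real m / (2 * real m + 1))) \<longlonglongrightarrow> 1" by real_asymp
  from tendsto_mult[OF central_binomial_even this]
  have "(\<lambda>m. ?x m * sqrt (2 * real m / (2 * real m + 1))) \<longlonglongrightarrow> sqrt (2 / pi)" by simp
  moreover have "?x m * sqrt (2 * real m / (2 * real m + 1)) =
      (2 * m choose (2 * m div 2)) * sqrt (2 * m) / 2 ^ (2 * m)" for m
    by (simp add: real_sqrt_divide power_mult)
  ultimately show "(\<lambda>m. (2 * m choose (2 * m div 2)) * sqrt (2 * m) / 2 ^ (2 * m)) \<longlonglongrightarrow> sqrt (2 / pi)"
    by simp
  \<comment> \<open>This factor is half the ratio of \<open>2 * m + 1 choose m\<close> to
    \<open>2 * m choose m\<close>; the half accounts for the additional power of 2.\<close>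
  have "(\<lambda>m. (2 * real m + 1) / (2 * (real m + 1))) \<longlonglongrightarrow> 1" by real_asymp
  from tendsto_mult[OF central_binomial_even this]
  have "(\<lambda>m. ?x m * ((2 * real m + 1) / (2 * (real m + 1)))) \<longlonglongrightarrow> sqrt (2 / pi)" by simp
  moreover have "?x m * ((2 * real m + 1) / (2 * (real m + 1))) =
      (2 * m + 1 choose ((2 * m + 1) div 2)) * sqrt (2 * m + 1) / 2 ^ (2 * m + 1)" for m
  proof -
    have "Suc m * (2 * m + 1 choose m) = (2 * m + 1) * (2 * m choose m)"
      using Suc_times_binomial[of m "2 * m"] binomial_symmetric[of m "2 * m + 1"] by simp
    then have "(real m + 1) * real (2 * m + 1 choose m) = (2 * real m + 1) * real (2 * m choose m)"
      by (metis (mono_tags, opaque_lifting) Suc_eq_plus1 of_nat_1 of_nat_add of_nat_mult of_nat_numeral)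
    then have "real (2 * m + 1 choose m) = (2 * real m + 1) * real (2 * m choose m) / (real m + 1)"
      by (simp add: field_simps)
    moreover have "1 + real m \<noteq> 0" by linarith
    ultimately show ?thesis by (simp add: power_mult add.commute divide_simps) (simp add: algebra_simps)
  qed
  ultimately show "(\<lambda>m. (2 * m + 1 choose ((2 * m + 1) div 2)) * sqrt (2 * m + 1) / 2 ^ (2 * m + 1))
      \<longlonglongrightarrow> sqrt (2 / pi)"
    by (simp add: add.commute)
qed

theorem theorem6p8:
  "\<exists>\<epsilon> :: nat \<Rightarrow> real. \<epsilon> \<in> o(\<lambda>_. 1) \<and>
     (\<forall>\<^sub>F n in sequentially.
        real (card (irreducible_classes {1..n}))
          \<ge> 2 powr ((sqrt (2 / pi) - \<epsilon> n) * 2 ^ n / real n powr (3 / 2)))"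
proof (intro exI conjI)
  \<comment> \<open>Taking \<open>\<epsilon>\<close> to be the error in the binomial asymptotics
    makes the exponent exactly \<open>(n choose (n div 2)) / n\<close>.\<close>
  let ?b = "\<lambda>n. (n choose (n div 2)) * sqrt n / 2 ^ n"
  have "(\<lambda>n. sqrt (2 / pi) - ?b n) \<longlonglongrightarrow> sqrt (2 / pi) - sqrt (2 / pi)"
    by (intro tendsto_intros middle_binomial_asymptotics)
  then show "(\<lambda>n. sqrt (2 / pi) - ?b n) \<in> o(\<lambda>_. 1)" by (intro smalloI_tendsto) auto
  \<comment> \<open>The bound \<open>n \<ge> 6\<close> ensures the size conditions of
    \<open>ex_large_paving_family\<close> for \<open>k = n div 2\<close>.\<close>
  have "2 powr ((sqrt (2 / pi) - (sqrt (2 / pi) - ?b n)) * 2 ^ n / real n powr (3 / 2))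
      \<le> real (card (irreducible_classes {1..n}))" if n: "n \<ge> 6" for n
  proof -
    have "2 \<le> n div 2" "n div 2 + 3 \<le> n" using n by auto
    then obtain C where C: "paving_family {1..n} (n div 2) C" "n choose (n div 2) \<le> n * card C"
      using ex_large_paving_family by metis
    have "real n powr (3 / 2) = real n * sqrt n"
      using n powr_add[of "real n" 1 "1/2"] by (simp add: powr_half_sqrt)
    then have "(sqrt (2 / pi) - (sqrt (2 / pi) - ?b n)) * 2 ^ n / real n powr (3 / 2)
        = real (n choose (n div 2)) / real n"
      using n by (simp add: field_simps)
    also have "\<dots> \<le> real (card C)"
      using C(2) n by (simp add: divide_le_eq mult.commute flip: of_nat_mult)
    finally have "2 powr ((sqrt (2 / pi) - (sqrt (2 / pi) - ?b n)) * 2 ^ n / real n powr (3 / 2))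
        \<le> 2 powr real (card C)" by (intro powr_mono) auto
    also have "\<dots> = real (2 ^ card C)" by (simp add: powr_realpow)
    also have "\<dots> \<le> real (card (irreducible_classes {1..n}))"
      using card_irreducible_classes_ge[OF C(1)] by (rule of_nat_mono)
    finally show ?thesis .
  qed
  then show "\<forall>\<^sub>F n in sequentially. 2 powr ((sqrt (2 / pi) - (sqrt (2 / pi) - ?b n)) * 2 ^ n / real n powr (3 / 2))
      \<le> real (card (irreducible_classes {1..n}))"
    unfolding eventually_sequentially by blast
qed

end
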